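(* Let $r\ge 2$, and let $G_1,G_2$ be finite simple graphs on disjoint vertex sets. Then $\Sigma_r(G_1 * G_2)$ is vertex decomposable if and only if both $\Sigma_r(G_1)$ and $\Sigma_r(G_2)$ are vertex decomposable.
   Context: For a graph $H$, $\Sigma_r(H)$ is the simplicial complex generated by $V(H)\setminus W$ over all $r$-subsets $W\subseteq V(H)$ with $H[W]$ connected (void complex if none). The join $G_1*G_2$ is the graph on $V(G_1)\cup V(G_2)$ with edges $E(G_1)\cup E(G_2)$ together with all $\{x,y\}$, $x\in V(G_1)$, $y\in V(G_2)$. A simplicial complex $\Delta$ is vertex decomposable if it is a simplex, the empty complex $\{\emptyset\}$, the void complex, or has a vertex $x$ with $\mathrm{lk}_\Delta(x)$ and $\mathrm{del}_\Delta(x)$ vertex decomposable and every facet of $\mathrm{del}_\Delta(x)$ a facet of $\Delta$. *)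

theory Defs
  imports "Graph_Theory.Digraph_Component"
begin

section \<open>Simplicial complexes\<close>

text \<open>
  A complex is represented by its set of faces. The void complex is \<open>{}\<close>
  (no faces), as opposed to the empty complex \<open>{{}}\<close>. The vertices are the points
  \<open>x\<close> with \<open>{x}\<close> a face; there is no separate ground set.
\<close>

definition finite_complex :: "'a set set \<Rightarrow> bool" where
  "finite_complex D \<longleftrightarrow> finite D \<and> (\<forall>F\<in>D. finite F \<and> (\<forall>E. E \<subseteq> F \<longrightarrow> E \<in> D))"

definition facet :: "'a set set \<Rightarrow> 'a set \<Rightarrow> bool" where
  "facet D F \<longleftrightarrow> F \<in> D \<and> (\<forall>E\<in>D. F \<subseteq> E \<longrightarrow> E = F)"

definition link :: "'a set set \<Rightarrow> 'a \<Rightarrow> 'a set set" where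
  "link D x = {F. x \<notin> F \<and> insert x F \<in> D}"

definition deletion :: "'a set set \<Rightarrow> 'a \<Rightarrow> 'a set set" where
  "deletion D x = {F \<in> D. x \<notin> F}"

inductive vertex_decomposable :: "'a set set \<Rightarrow> bool" where
  simplex: "finite S \<Longrightarrow> vertex_decomposable (Pow S)"
| empty_complex: "vertex_decomposable {{}}"
| void_complex: "vertex_decomposable {}"
| shed: "\<lbrakk>finite_complex D; {x} \<in> D;
          vertex_decomposable (link D x); vertex_decomposable (deletion D x);
          \<And>F. facet (deletion D x) F \<Longrightarrow> facet D F\<rbrakk> \<Longrightarrow> vertex_decomposable D"

definition generated_complex :: "'a set set \<Rightarrow> 'a set set" where
  "generated_complex A = {F. \<exists>S\<in>A. F \<subseteq> S}"

lemma finite_complex_generated: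
  assumes "finite A" "\<And>S. S \<in> A \<Longrightarrow> finite S"
  shows "finite_complex (generated_complex A)"
proof -
  have "generated_complex A = (\<Union>S\<in>A. Pow S)"
    by (auto simp: generated_complex_def)
  then show ?thesis
    using assms by (simp add: finite_complex_def) (blast intro: finite_subset)
qed

lemma vertex_decomposable_finite_complex:
  "vertex_decomposable D \<Longrightarrow> finite_complex D"
  by (induction rule: vertex_decomposable.induct)
    (auto simp: finite_complex_def intro: finite_subset)


section \<open>Graphs\<close>

text \<open>
  A finite simple graph is a \<^locale>\<open>pair_graph\<close>: a finite vertex set with a symmetric,
  irreflexive set of arcs, the edge \<open>{u, v}\<close> being the pair of arcs
  \<open>(u, v)\<close> and \<open>(v, u)\<close>.
\<close>

definition graph_join :: "'a pair_pre_digraph \<Rightarrow> 'a pair_pre_digraph \<Rightarrow> 'a pair_pre_digraph" where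
  "graph_join G H =
     \<lparr>pverts = pverts G \<union> pverts H,
      parcs = parcs G \<union> parcs H \<union> (pverts G \<times> pverts H) \<union> (pverts H \<times> pverts G)\<rparr>"

lemma pair_graph_graph_join:
  assumes "pair_graph G" "pair_graph H" "pverts G \<inter> pverts H = {}"
  shows "pair_graph (graph_join G H)"
proof -
  interpret G: pair_graph G by fact
  interpret H: pair_graph H by fact
  have s: "sym (parcs G)" "sym (parcs H)"
    using G.pair_sym_arcs H.pair_sym_arcs by (auto simp: symmetric_def)
  have "sym (parcs (graph_join G H))"
    using s by (auto simp: graph_join_def sym_def)
  then show ?thesis
    using assms(3) G.pair_no_loops H.pair_no_loops
    by unfold_locales
      (auto simp: graph_join_def symmetric_def G.wellformed' H.wellformed')
qed

definition Sigma_complex :: "nat \<Rightarrow> 'a pair_pre_digraph \<Rightarrow> 'a set set" where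
  "Sigma_complex r H =
     generated_complex
       {pverts H - W | W. W \<subseteq> pverts H \<and> card W = r \<and>
          Digraph_Component.connected (with_proj H \<restriction> W)}"

lemma finite_complex_Sigma_complex:
  assumes "finite (pverts H)"
  shows "finite_complex (Sigma_complex r H)"
  unfolding Sigma_complex_def
  by (rule finite_complex_generated) (use assms in auto)

end

theory Submission
  imports Defs
begin

text \<open>
  A set with a point in each part is connected in the join, so a set of at most \<open>n - r\<close>
  vertices is a face of the join's complex unless it contains a whole part, in which case its
  trace on the other part must be a face there. Hence each \<open>\<Sigma>\<^sub>r(G\<^sub>i)\<close> is the link of the opposite
  part, and links inherit vertex decomposability. Conversely, a shedding vertex \<open>v\<close> of
  \<open>\<Sigma>\<^sub>r(G\<^sub>1)\<close> sheds the join's complex: the link has the same shape over \<open>V\<^sub>1 - {v}\<close>, and so does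
  the deletion, with \<open>r\<close> lowered by one and a full skeleton in place of \<open>\<Sigma>\<^sub>r(G\<^sub>2)\<close>. When \<open>r\<close>
  has dropped to 1 the complex is pure of codimension one, and all of those are vertex
  decomposable.
\<close>

section \<open>Links and shedding\<close>

lemma finite_complexD:
  assumes "finite_complex D" "F \<in> D"
  shows "finite F" and "E \<subseteq> F \<Longrightarrow> E \<in> D"
  using assms by (auto simp: finite_complex_def)

lemma finite_complexI:
  assumes "finite V" "\<And>F. F \<in> D \<Longrightarrow> F \<subseteq> V" "\<And>E F. F \<in> D \<Longrightarrow> E \<subseteq> F \<Longrightarrow> E \<in> D"
  shows "finite_complex D"
proof -
  have "D \<subseteq> Pow V" using assms(2) by auto
  then have "finite D" using assms(1) by (metis finite_Pow_iff finite_subset)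
  then show ?thesis
    using assms unfolding finite_complex_def by (meson finite_subset)
qed

lemma finite_complex_link:
  assumes "finite_complex D"
  shows "finite_complex (link D x)"
proof (rule finite_complexI)
  show "finite (\<Union>D)" using assms by (auto simp: finite_complex_def)
  show "F \<subseteq> \<Union>D" if "F \<in> link D x" for F
    using that by (auto simp: link_def)
  show "E \<in> link D x" if "F \<in> link D x" "E \<subseteq> F" for E F
  proof -
    have "insert x F \<in> D" "x \<notin> F" using that by (auto simp: link_def)
    moreover have "insert x E \<subseteq> insert x F" using that by auto
    ultimately show ?thesis
      using finite_complexD(2)[OF assms] that by (auto simp: link_def)
  qed
qed

lemma deletion_eq_self:
  assumes "finite_complex D" "{x} \<notin> D"
  shows "deletion D x = D"
  using assms finite_complexD(2)[OF assms(1), of _ "{x}"]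
  by (auto simp: deletion_def)

text \<open>This also covers a point \<open>x\<close> that is not a vertex of \<open>D\<close>: the
  deletion is then \<open>D\<close> itself, and its decomposability is the claim.\<close>

lemma vertex_decomposable_shed:
  assumes "finite_complex D" "vertex_decomposable (link D x)"
    "vertex_decomposable (deletion D x)"
    "\<And>F. facet (deletion D x) F \<Longrightarrow> facet D F"
  shows "vertex_decomposable D"
  using assms deletion_eq_self[of D x] vertex_decomposable.shed[of D x] by metis

section \<open>Links against links, deletions and facets\<close>

lemma link_link_commute: "link (link D x) y = link (link D y) x"
  by (auto simp: link_def insert_commute)

lemma deletion_link_commute: "x \<noteq> y \<Longrightarrow> deletion (link D x) y = link (deletion D y) x"
  by (auto simp: link_def deletion_def)

lemma facet_link:
  assumes "facet D (insert x F)" "x \<notin> F"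
  shows "facet (link D x) F"
  unfolding facet_def
proof (intro conjI ballI impI)
  show "F \<in> link D x" using assms by (simp add: facet_def link_def)
  fix E assume E: "E \<in> link D x" "F \<subseteq> E"
  then have "insert x E = insert x F" "x \<notin> E"
    using assms(1) by (auto simp: facet_def link_def)
  then show "E = F" using assms(2) by (simp add: insert_ident)
qed

lemma facet_link_insert:
  assumes "facet (link D x) F"
  shows "facet D (insert x F)"
  unfolding facet_def
proof (intro conjI ballI impI)
  show "insert x F \<in> D" using assms by (simp add: facet_def link_def)
  fix E assume E: "E \<in> D" "insert x F \<subseteq> E"
  then have "E - {x} \<in> link D x" "F \<subseteq> E - {x}"
    using assms by (auto simp: facet_def link_def insert_absorb)
  then have "E - {x} = F" using assms by (simp add: facet_def)
  then show "E = insert x F" using E by auto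
qed

text \<open>Induction on the derivation. A shedding vertex \<open>y\<close> other than
  \<open>x\<close> still sheds \<open>link D x\<close>: links commute with links and deletions, and
  facets of a link at \<open>x\<close> are the facets through \<open>x\<close> with \<open>x\<close>
  removed.\<close>

lemma vertex_decomposable_link:
  "vertex_decomposable D \<Longrightarrow> vertex_decomposable (link D x)"
proof (induction rule: vertex_decomposable.induct)
  case (simplex S)
  have "link (Pow S) x = (if x \<in> S then Pow (S - {x}) else {})"
    by (auto simp: link_def)
  then show ?case
    using simplex
    by (auto intro: vertex_decomposable.simplex vertex_decomposable.void_complex)
next
  case empty_complex
  have "link {{}} x = {}" by (auto simp: link_def)
  then show ?case by (simp add: vertex_decomposable.void_complex)
next
  case void_complex
  have "link {} x = {}" by (auto simp: link_def)
  then show ?case by (simp add: vertex_decomposable.void_complex)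
next
  case (shed D y)
  show ?case
  proof (cases "x = y")
    case True
    then show ?thesis using shed by simp
  next
    case False
    show ?thesis
    \<comment> \<open>\<open>y\<close> may fail to be a vertex of \<open>link D x\<close>, which
      this rule tolerates.\<close>
    proof (rule vertex_decomposable_shed)
      show "finite_complex (link D x)" using shed.hyps(1) by (rule finite_complex_link)
      show "vertex_decomposable (link (link D x) y)"
        using shed.IH(1) by (simp add: link_link_commute[of D x y])
      show "vertex_decomposable (deletion (link D x) y)"
        using shed.IH(2) False by (simp add: deletion_link_commute)
      fix F assume "facet (deletion (link D x) y) F"
      then have F: "facet (link (deletion D y) x) F"
        using False by (simp add: deletion_link_commute)
      then have "x \<notin> F" by (simp add: facet_def link_def)
      with F show "facet (link D x) F"
        using facet_link facet_link_insert shed.hyps by metis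
    qed
  qed
qed

text \<open>The complex is the link of the set \<open>S\<close>, reached by taking links at its
  points one after the other.\<close>

lemma vertex_decomposable_link_face:
  assumes "finite S" "vertex_decomposable D"
  shows "vertex_decomposable {F. F \<inter> S = {} \<and> F \<union> S \<in> D}"
  using assms
proof (induction S arbitrary: D)
  case empty
  then show ?case by simp
next
  case (insert x S)
  have "{F. F \<inter> insert x S = {} \<and> F \<union> insert x S \<in> D} =
    {F. F \<inter> S = {} \<and> F \<union> S \<in> link D x}"
    using insert.hyps by (auto simp: link_def)
  then show ?case using insert vertex_decomposable_link by metis
qed


section \<open>Pure complexes of given codimension\<close>

text \<open>Codimension is counted in a ground set \<open>V\<close> that may contain non-vertices,
  so it behaves predictably when a point is removed. The void complex qualifies for every
  \<open>s\<close>.\<close>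

definition codim_pure :: "nat \<Rightarrow> 'a set \<Rightarrow> 'a set set \<Rightarrow> bool" where
  "codim_pure s V D \<longleftrightarrow> (\<forall>F\<in>D. F \<subseteq> V \<and> card F + s \<le> card V \<and>
     (\<exists>E\<in>D. F \<subseteq> E \<and> card E + s = card V))"

text \<open>Written with addition so that \<open>s\<close> greater than \<open>card V\<close> yields
  the void complex; truncated subtraction would leave the empty face.\<close>

definition skeleton :: "nat \<Rightarrow> 'a set \<Rightarrow> 'a set set" where
  "skeleton s V = {F. F \<subseteq> V \<and> card F + s \<le> card V}"

lemma codim_pure_skeleton: "codim_pure s V D \<Longrightarrow> D \<subseteq> skeleton s V"
  by (auto simp: codim_pure_def skeleton_def)

lemma codim_pure_facet:
  assumes "codim_pure s V D" "facet D F"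
  shows "card F + s = card V"
  using assms unfolding codim_pure_def facet_def by metis

lemma finite_complex_skeleton_subset:
  assumes "finite V" "D \<subseteq> skeleton s V" "\<And>E F. F \<in> D \<Longrightarrow> E \<subseteq> F \<Longrightarrow> E \<in> D"
  shows "finite_complex D"
  using assms by (intro finite_complexI[of V]) (auto simp: skeleton_def)

text \<open>Facets of the deletion have \<open>card V - Suc s\<close> points, the largest size that
  the skeleton bound allows in \<open>D\<close>, so they remain facets of \<open>D\<close>.\<close>

lemma vertex_decomposable_shed_pure:
  assumes "finite V" "v \<in> V" "finite_complex D" "D \<subseteq> skeleton (Suc s) V"
    "codim_pure s (V - {v}) (deletion D v)"
    "vertex_decomposable (link D v)" "vertex_decomposable (deletion D v)"
  shows "vertex_decomposable D"
proof (rule vertex_decomposable_shed[of D v])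
  fix F assume F: "facet (deletion D v) F"
  have "card F + s = card (V - {v})" using codim_pure_facet[OF assms(5) F] .
  then have card_F: "card F + Suc s = card V"
    using assms(1,2) by (metis add_Suc_right card_Suc_Diff1)
  show "facet D F"
    unfolding facet_def
  proof (intro conjI ballI impI)
    show "F \<in> D" using F by (simp add: facet_def deletion_def)
    fix E assume E: "E \<in> D" "F \<subseteq> E"
    then have "card E \<le> card F" using assms(4) card_F by (auto simp: skeleton_def)
    then show "E = F"
      using E finite_complexD(1)[OF assms(3)] by (metis card_seteq)
  qed
qed (use assms in auto)

text \<open>Passing to the link removes \<open>v\<close> from the faces and from the ground set
  alike, so \<open>s\<close> stays.\<close>

lemma codim_pure_link:
  assumes "codim_pure s V D" "finite V" "v \<in> V"
  shows "codim_pure s (V - {v}) (link D v)"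
  unfolding codim_pure_def
proof (intro ballI conjI)
  have cV: "card V = Suc (card (V - {v}))" using assms(2,3) by (rule card.remove)
  fix F assume "F \<in> link D v"
  then have F: "v \<notin> F" "insert v F \<in> D" by (auto simp: link_def)
  then have sub: "insert v F \<subseteq> V" and le: "card (insert v F) + s \<le> card V"
    using assms(1) by (auto simp: codim_pure_def)
  then show "F \<subseteq> V - {v}" using F by auto
  have "finite F" using sub assms(2) finite_subset[of F V] by simp
  then show "card F + s \<le> card (V - {v})" using le cV F by simp
  obtain E where E: "E \<in> D" "insert v F \<subseteq> E" "card E + s = card V"
    using assms(1) F unfolding codim_pure_def by metis
  have "E \<subseteq> V" using E(1) assms(1) by (simp add: codim_pure_def)
  then have "finite E" using assms(2) by (rule finite_subset)
  then have "card E = Suc (card (E - {v}))" using E(2) by (intro card.remove) auto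
  then have "card (E - {v}) + s = card (V - {v})" using E(3) cV by linarith
  moreover have "E - {v} \<in> link D v" using E by (auto simp: link_def insert_absorb)
  moreover have "F \<subseteq> E - {v}" using E F by auto
  ultimately show "\<exists>E\<in>link D v. F \<subseteq> E \<and> card E + s = card (V - {v})" by blast
qed

text \<open>The shedding condition gives the facets of the deletion the size of facets of
  \<open>D\<close>, while the ground set loses a point: the codimension drops by one.\<close>

lemma codim_pure_deletion_facets:
  assumes "codim_pure (Suc s) V D" "finite V" "v \<in> V" "finite_complex D"
    "\<And>F. facet (deletion D v) F \<Longrightarrow> facet D F"
  shows "codim_pure s (V - {v}) (deletion D v)"
  unfolding codim_pure_def
proof (intro ballI conjI)
  have cV: "card V = Suc (card (V - {v}))" using assms(2,3) by (rule card.remove)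
  fix F assume F: "F \<in> deletion D v"
  then show "F \<subseteq> V - {v}" and "card F + s \<le> card (V - {v})"
    using assms(1) cV by (auto simp: codim_pure_def deletion_def)
  have "finite (deletion D v)" using assms(4) by (simp add: finite_complex_def deletion_def)
  from finite_has_maximal2[OF this F] obtain E where
    E: "E \<in> deletion D v" "F \<subseteq> E" "\<forall>B\<in>deletion D v. E \<subseteq> B \<longrightarrow> E = B" by blast
  then have "facet (deletion D v) E" by (auto simp: facet_def)
  then have "card E + Suc s = card V" using assms(1,5) codim_pure_facet by blast
  with E cV show "\<exists>E\<in>deletion D v. F \<subseteq> E \<and> card E + s = card (V - {v})" by auto
qed

text \<open>
  The vertex \<open>v\<close> need not belong to the complex: for a simplex it is a ground-set point
  outside of it.
\<close>

lemma codim_pure_shedding_vertex: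
  assumes "vertex_decomposable D" "codim_pure (Suc s) V D" "finite V" "V \<noteq> {}"
  obtains v where "v \<in> V" "vertex_decomposable (link D v)" "vertex_decomposable (deletion D v)"
    "codim_pure s (V - {v}) (deletion D v)"
proof -
  have fc: "finite_complex D" using assms(1) by (rule vertex_decomposable_finite_complex)
  note found = that
  have simplex_case: thesis if "D = Pow S" for S
  proof -
    have "S \<in> D" using that by simp
    \<comment> \<open>The codimension \<open>Suc s\<close> is positive, so \<open>S\<close> misses a
      point of \<open>V\<close>.\<close>
    then have S: "S \<subseteq> V" "card S < card V" using assms(2) unfolding codim_pure_def by fastforce+
    then obtain v where v: "v \<in> V" "v \<notin> S" by (metis less_irrefl subset_antisym subsetI)
    then have del: "deletion D v = D" using that by (auto simp: deletion_def)
    show thesis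
    proof (rule found[OF v(1)])
      show "vertex_decomposable (link D v)" using assms(1) by (rule vertex_decomposable_link)
      show "codim_pure s (V - {v}) (deletion D v)"
        using codim_pure_deletion_facets[OF assms(2,3) v(1) fc] del by simp
    qed (simp add: del assms(1))
  qed
  show thesis
    using assms(1)
  proof cases
    case (simplex S)
    then show ?thesis using simplex_case by blast
  next
    case empty_complex
    then show ?thesis using simplex_case[of "{}"] by simp
  next
    case void_complex
    obtain v where "v \<in> V" using assms(4) by blast
    moreover have "link D v = {}" "deletion D v = {}"
      using void_complex by (auto simp: link_def deletion_def)
    ultimately show ?thesis
      using found by (simp add: codim_pure_def vertex_decomposable.void_complex)
  next
    case (shed x)
    then have "x \<in> V" using assms(2) by (auto simp: codim_pure_def)
    then show ?thesis
      using found[of x] shed codim_pure_deletion_facets[OF assms(2,3) _ fc] by blast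
  qed
qed

text \<open>A facet misses exactly one point \<open>v\<close>. Deleting \<open>v\<close> leaves the
  full simplex on \<open>V - {v}\<close>, and the link of \<open>v\<close> is again pure of
  codimension one, on a smaller ground set.\<close>

lemma vertex_decomposable_codim_1:
  assumes "finite V" "finite_complex D" "codim_pure 1 V D"
  shows "vertex_decomposable D"
  using assms
proof (induction V arbitrary: D rule: finite_psubset_induct)
  case (psubset V)
  show ?case
  proof (cases "D = {}")
    case True
    then show ?thesis by (simp add: vertex_decomposable.void_complex)
  next
    case False
    then obtain E where E: "E \<in> D" "E \<subseteq> V" "card E + 1 = card V"
      using psubset.prems(2) unfolding codim_pure_def by (metis all_not_in_conv)
    have "card (V - E) = 1"
      using E psubset.hyps by (simp add: card_Diff_subset finite_subset)
    then obtain v where "V - E = {v}" by (auto simp: card_1_singleton_iff)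
    then have v: "v \<in> V" "E = V - {v}" using E by auto
    have del: "deletion D v = Pow (V - {v})"
      using psubset.prems(2) E(1) v finite_complexD(2)[OF psubset.prems(1) E(1)]
      by (auto simp: deletion_def codim_pure_def)
    show ?thesis
    proof (rule vertex_decomposable_shed_pure[where s = 0])
      show "finite V" "v \<in> V" "finite_complex D" by (fact psubset v)+
      show "D \<subseteq> skeleton (Suc 0) V" using psubset.prems codim_pure_skeleton by force
      show "codim_pure 0 (V - {v}) (deletion D v)"
        unfolding del codim_pure_def using psubset.hyps by (auto intro: card_mono)
      show "vertex_decomposable (deletion D v)"
        unfolding del using psubset.hyps by (intro vertex_decomposable.simplex) simp
      show "vertex_decomposable (link D v)"
      proof (rule psubset.IH)
        show "V - {v} \<subset> V" using v by auto
      qed (use psubset v finite_complex_link codim_pure_link in auto)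
    qed
  qed
qed

section \<open>Full skeleta of a simplex\<close>

lemma codim_pure_full_skeleton:
  assumes "finite V"
  shows "codim_pure s V (skeleton s V)"
  unfolding codim_pure_def
proof (intro ballI conjI)
  fix F assume F: "F \<in> skeleton s V"
  then show "F \<subseteq> V" "card F + s \<le> card V" by (auto simp: skeleton_def)
  \<comment> \<open>The subtraction is exact, since the bound on \<open>F\<close> forces
    \<open>s\<close> to be at most \<open>card V\<close>.\<close>
  moreover from this have "card F \<le> card V - s" by simp
  ultimately obtain E where "F \<subseteq> E" "E \<subseteq> V" "card E = card V - s"
    using exists_subset_between[of F "card V - s" V] assms by auto
  with F show "\<exists>E\<in>skeleton s V. F \<subseteq> E \<and> card E + s = card V"
    by (auto simp: skeleton_def)
qed

lemma finite_complex_skeleton: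
  assumes "finite V"
  shows "finite_complex (skeleton s V)"
proof (rule finite_complex_skeleton_subset[OF assms order_refl])
  fix E F assume "F \<in> skeleton s V" "E \<subseteq> F"
  then show "E \<in> skeleton s V"
    using assms card_mono[of F E] finite_subset[of F V] by (auto simp: skeleton_def)
qed

lemma link_skeleton:
  assumes "finite V" "v \<in> V"
  shows "link (skeleton s V) v = skeleton s (V - {v})"
proof -
  obtain W where W: "V = insert v W" "v \<notin> W" using assms(2) by (rule Set.set_insert)
  have "finite W" using assms(1) W by simp
  then have "card (insert v F) = Suc (card F)" if "F \<subseteq> W" for F
    using that W(2) by (intro card_insert_disjoint) (auto simp: finite_subset)
  then show ?thesis
    using W(2) \<open>finite W\<close> unfolding W(1) by (auto simp: link_def skeleton_def subset_insert)
qed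

text \<open>Unlike in the link, only the ground set shrinks and the faces keep their size, hence
  \<open>s\<close> in place of \<open>Suc s\<close>.\<close>

lemma deletion_skeleton:
  assumes "finite V" "v \<in> V"
  shows "deletion (skeleton (Suc s) V) v = skeleton s (V - {v})"
proof -
  obtain W where W: "V = insert v W" "v \<notin> W" using assms(2) by (rule Set.set_insert)
  have "finite W" using assms(1) W by simp
  then show ?thesis
    using W(2) unfolding W(1) by (auto simp: deletion_def skeleton_def subset_insert)
qed

text \<open>Every point of \<open>V\<close> sheds, since link and deletion are skeleta on a smaller
  ground set. The recursion ends in a simplex (\<open>s = 0\<close>) or in the void complex
  (\<open>V\<close> empty, \<open>s\<close> positive).\<close>

lemma vertex_decomposable_skeleton:
  assumes "finite V"
  shows "vertex_decomposable (skeleton s V)"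
  using assms
proof (induction V arbitrary: s rule: finite_psubset_induct)
  case (psubset V)
  show ?case
  proof (cases s)
    case 0
    then have "skeleton s V = Pow V"
      using psubset.hyps by (auto simp: skeleton_def card_mono)
    then show ?thesis using psubset.hyps by (simp add: vertex_decomposable.simplex)
  next
    case (Suc t)
    show ?thesis
    proof (cases "V = {}")
      case True
      then have "skeleton s V = {}" using Suc by (auto simp: skeleton_def)
      then show ?thesis by (simp add: vertex_decomposable.void_complex)
    next
      case False
      then obtain v where v: "v \<in> V" by blast
      have "V - {v} \<subset> V" using v by auto
      note IH = psubset.IH[OF this]
      show ?thesis
        unfolding Suc
      proof (rule vertex_decomposable_shed_pure[OF psubset.hyps v])
        show "finite_complex (skeleton (Suc t) V)"
          using psubset.hyps by (rule finite_complex_skeleton)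
        show "codim_pure t (V - {v}) (deletion (skeleton (Suc t) V) v)"
          using psubset.hyps v by (simp add: deletion_skeleton codim_pure_full_skeleton)
      qed (use psubset.hyps v IH in \<open>simp_all add: deletion_skeleton link_skeleton\<close>)
    qed
  qed
qed


section \<open>The join complex\<close>

text \<open>The shape of the complex of a graph join, with \<open>s\<close> and both
  \<open>C1\<close>, \<open>C2\<close> left free so that links and deletions have the same shape. It
  is not the simplicial join of \<open>C1\<close> and \<open>C2\<close>.\<close>

definition join_complex ::
    "nat \<Rightarrow> 'a set \<Rightarrow> 'a set \<Rightarrow> 'a set set \<Rightarrow> 'a set set \<Rightarrow> 'a set set" where
  "join_complex s V1 V2 C1 C2 = {F \<in> skeleton s (V1 \<union> V2).
     (V2 \<subseteq> F \<longrightarrow> F \<inter> V1 \<in> C1) \<and> (V1 \<subseteq> F \<longrightarrow> F \<inter> V2 \<in> C2)}"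

lemma finite_complex_join_complex:
  assumes "finite V1" "finite V2" "finite_complex C1" "finite_complex C2"
  shows "finite_complex (join_complex s V1 V2 C1 C2)"
proof (rule finite_complex_skeleton_subset)
  show "finite (V1 \<union> V2)" using assms by simp
  show "join_complex s V1 V2 C1 C2 \<subseteq> skeleton s (V1 \<union> V2)" by (auto simp: join_complex_def)
  fix E F assume F: "F \<in> join_complex s V1 V2 C1 C2" and E: "E \<subseteq> F"
  have "E \<in> skeleton s (V1 \<union> V2)"
    using F E finite_complexD(2)[OF finite_complex_skeleton[of "V1 \<union> V2"]] assms
    by (auto simp: join_complex_def)
  moreover have "E \<inter> V1 \<in> C1" if "V2 \<subseteq> E"
    using F E that finite_complexD(2)[OF assms(3), of "F \<inter> V1" "E \<inter> V1"]
    by (auto simp: join_complex_def)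
  moreover have "E \<inter> V2 \<in> C2" if "V1 \<subseteq> E"
    using F E that finite_complexD(2)[OF assms(4), of "F \<inter> V2" "E \<inter> V2"]
    by (auto simp: join_complex_def)
  ultimately show "E \<in> join_complex s V1 V2 C1 C2" by (simp add: join_complex_def)
qed

text \<open>A face containing \<open>V2\<close> grows inside \<open>V1\<close> by purity of
  \<open>C1\<close>. Any other face misses some \<open>w\<close> in \<open>V2\<close> and can grow
  freely while avoiding \<open>w\<close>.\<close>

lemma codim_pure_join_complex_skeleton:
  assumes fin: "finite V1" "finite V2" and dis: "V1 \<inter> V2 = {}"
    and C1: "codim_pure s V1 C1" and s: "s \<ge> 1"
  shows "codim_pure s (V1 \<union> V2) (join_complex s V1 V2 C1 (skeleton s V2))"
  unfolding codim_pure_def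
proof (intro ballI conjI)
  have cV: "card (V1 \<union> V2) = card V1 + card V2" using fin dis by (simp add: card_Un_disjoint)
  fix F assume F: "F \<in> join_complex s V1 V2 C1 (skeleton s V2)"
  then show FV: "F \<subseteq> V1 \<union> V2" and le: "card F + s \<le> card (V1 \<union> V2)"
    by (auto simp: join_complex_def skeleton_def)
  show "\<exists>E\<in>join_complex s V1 V2 C1 (skeleton s V2). F \<subseteq> E \<and> card E + s = card (V1 \<union> V2)"
  proof (cases "V2 \<subseteq> F")
    case True
    then have "F \<inter> V1 \<in> C1" using F by (simp add: join_complex_def)
    then obtain A where A: "A \<in> C1" "F \<inter> V1 \<subseteq> A" "A \<subseteq> V1" "card A + s = card V1"
      using C1 unfolding codim_pure_def by metis
    have "card (A \<union> V2) = card A + card V2"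
      using A fin dis finite_subset[of A V1] by (intro card_Un_disjoint) auto
    then have card_E: "card (A \<union> V2) + s = card (V1 \<union> V2)" using A cV by simp
    \<comment> \<open>As \<open>s\<close> is positive, \<open>A\<close> is a proper subset of
      \<open>V1\<close>, which makes the condition on the trace in \<open>V2\<close>
      vacuous.\<close>
    have "A \<noteq> V1" using A s by auto
    then have "\<not> V1 \<subseteq> A \<union> V2" using A dis by auto
    moreover have "(A \<union> V2) \<inter> V1 = A" using A dis by auto
    ultimately have "A \<union> V2 \<in> join_complex s V1 V2 C1 (skeleton s V2)"
      using A card_E by (auto simp: join_complex_def skeleton_def)
    moreover have "F \<subseteq> A \<union> V2" using FV A by auto
    ultimately show ?thesis using card_E by blast
  next
    case False
    then obtain w where w: "w \<in> V2" "w \<notin> F" by blast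
    have "card (V1 \<union> V2 - {w}) + 1 = card (V1 \<union> V2)"
      using w fin by (metis Suc_eq_plus1 UnI2 card_Suc_Diff1 finite_UnI)
    \<comment> \<open>Positivity of \<open>s\<close> leaves room for a set of the required size that
      omits \<open>w\<close>.\<close>
    then have "card (V1 \<union> V2) - s \<le> card (V1 \<union> V2 - {w})" using s by linarith
    moreover have "card F \<le> card (V1 \<union> V2) - s" using le by simp
    moreover have "F \<subseteq> V1 \<union> V2 - {w}" using FV w by auto
    ultimately obtain E where E: "F \<subseteq> E" "E \<subseteq> V1 \<union> V2 - {w}" "card E = card (V1 \<union> V2) - s"
      using exists_subset_between[of F "card (V1 \<union> V2) - s" "V1 \<union> V2 - {w}"] fin
      by auto
    then have card_E: "card E + s = card (V1 \<union> V2)" using le by simp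
    have "E \<inter> V2 \<in> skeleton s V2" if "V1 \<subseteq> E"
    proof -
      have "card E = card (V1 \<union> (E \<inter> V2))" using E that by (intro arg_cong[of _ _ card]) auto
      also have "\<dots> = card V1 + card (E \<inter> V2)"
        using fin dis by (intro card_Un_disjoint) auto
      finally show ?thesis using card_E cV by (simp add: skeleton_def)
    qed
    then have "E \<in> join_complex s V1 V2 C1 (skeleton s V2)"
      using E w card_E by (auto simp: join_complex_def skeleton_def)
    then show ?thesis using E card_E by blast
  qed
qed

section \<open>Links and deletions of the join complex\<close>

text \<open>As \<open>v\<close> lies outside \<open>V2\<close>, adding it to a set affects neither
  the trace on \<open>V2\<close> nor whether \<open>V2\<close> is contained; the size bound keeps
  \<open>s\<close> because both sides gain one point.\<close>

lemma link_join_complex: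
  fixes V1 V2 :: "'a set"
  assumes fin: "finite V1" "finite V2" and dis: "V1 \<inter> V2 = {}" and v: "v \<in> V1"
  shows "link (join_complex s V1 V2 C1 C2) v = join_complex s (V1 - {v}) V2 (link C1 v) C2"
proof -
  have v2: "v \<notin> V2" using dis v by auto
  have "V1 \<union> V2 - {v} = (V1 - {v}) \<union> V2" using v2 by auto
  then have sk: "link (skeleton s (V1 \<union> V2)) v = skeleton s ((V1 - {v}) \<union> V2)"
    using link_skeleton[of "V1 \<union> V2" v s] fin v by simp
  have aux: "insert v F \<in> skeleton s (V1 \<union> V2) \<longleftrightarrow> F \<in> skeleton s ((V1 - {v}) \<union> V2)"
    if "v \<notin> F" for F
    using that sk by (auto simp: link_def)
  have nin: "v \<notin> F" if "F \<in> join_complex s (V1 - {v}) V2 (link C1 v) C2" for F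
    using that v2 by (auto simp: join_complex_def skeleton_def)
  have "insert v F \<in> join_complex s V1 V2 C1 C2 \<longleftrightarrow>
      F \<in> join_complex s (V1 - {v}) V2 (link C1 v) C2" if vF: "v \<notin> F" for F
  proof -
    have "V2 \<subseteq> insert v F \<longleftrightarrow> V2 \<subseteq> F" using v2 by auto
    moreover have "V1 \<subseteq> insert v F \<longleftrightarrow> V1 - {v} \<subseteq> F" by auto
    moreover have "insert v F \<inter> V2 = F \<inter> V2" using v2 by auto
    moreover have "insert v F \<inter> V1 = insert v (F \<inter> (V1 - {v}))" using v vF by auto
    ultimately show ?thesis
      using aux[OF vF] by (simp add: join_complex_def link_def)
  qed
  moreover have "F \<in> link D v \<longleftrightarrow> v \<notin> F \<and> insert v F \<in> D" for F :: "'a set" and D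
    by (simp add: link_def)
  ultimately show ?thesis using nin by (intro set_eqI) metis
qed

text \<open>
  A face avoiding \<open>v \<in> V1\<close> never contains \<open>V1\<close>, so the condition on \<open>C2\<close> disappears; it is
  replaced by a full skeleton, for which the condition is automatic.
\<close>

lemma deletion_join_complex:
  assumes fin: "finite V1" "finite V2" and dis: "V1 \<inter> V2 = {}" and v: "v \<in> V1"
  shows "deletion (join_complex (Suc s) V1 V2 C1 C2) v =
    join_complex s (V1 - {v}) V2 (deletion C1 v) (skeleton s V2)"
proof -
  have v2: "v \<notin> V2" using dis v by auto
  have "V1 \<union> V2 - {v} = (V1 - {v}) \<union> V2" using v2 by auto
  then have sk: "deletion (skeleton (Suc s) (V1 \<union> V2)) v = skeleton s ((V1 - {v}) \<union> V2)"
    using deletion_skeleton[of "V1 \<union> V2" v s] fin v by simp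
  \<comment> \<open>If \<open>F\<close> covers \<open>V1 - {v}\<close>, all of the at least
    \<open>s\<close> points it misses lie in \<open>V2\<close>.\<close>
  have full: "F \<inter> V2 \<in> skeleton s V2"
    if F: "F \<in> skeleton s ((V1 - {v}) \<union> V2)" "V1 - {v} \<subseteq> F" for F
  proof -
    have "card F = card ((V1 - {v}) \<union> (F \<inter> V2))"
      using F by (intro arg_cong[of _ _ card]) (auto simp: skeleton_def)
    also have "\<dots> = card (V1 - {v}) + card (F \<inter> V2)"
      using fin dis by (intro card_Un_disjoint) auto
    finally have "card F = card (V1 - {v}) + card (F \<inter> V2)" .
    moreover have "card ((V1 - {v}) \<union> V2) = card (V1 - {v}) + card V2"
      using fin dis by (intro card_Un_disjoint) auto
    ultimately show ?thesis using F by (simp add: skeleton_def)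
  qed
  have del_iff: "F \<in> deletion (join_complex (Suc s) V1 V2 C1 C2) v \<longleftrightarrow>
      F \<in> deletion (skeleton (Suc s) (V1 \<union> V2)) v \<and> (V2 \<subseteq> F \<longrightarrow> F \<inter> V1 \<in> deletion C1 v)" for F
    using v by (auto simp: deletion_def join_complex_def)
  have join_iff: "F \<in> join_complex s (V1 - {v}) V2 (deletion C1 v) (skeleton s V2) \<longleftrightarrow>
      F \<in> skeleton s ((V1 - {v}) \<union> V2) \<and> (V2 \<subseteq> F \<longrightarrow> F \<inter> V1 \<in> deletion C1 v)" for F
  proof -
    have "F \<inter> (V1 - {v}) = F \<inter> V1" if "F \<in> skeleton s ((V1 - {v}) \<union> V2)"
      using that v2 by (auto simp: skeleton_def)
    then show ?thesis using full by (auto simp: join_complex_def)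
  qed
  show ?thesis by (intro set_eqI) (simp only: del_iff join_iff sk)
qed

text \<open>
  Deleting a vertex lowers \<open>s\<close>, and the complex need not stay pure at \<open>s = 1\<close> for general
  \<open>C2\<close>. Since the deletion makes \<open>C2\<close> a full skeleton, the last hypothesis is preserved.
\<close>

lemma vertex_decomposable_join_complex:
  assumes "finite V1" "finite V2" "V1 \<inter> V2 = {}"
    "vertex_decomposable C1" "vertex_decomposable C2"
    "codim_pure s V1 C1" "C2 \<subseteq> skeleton s V2"
    "s \<ge> 2 \<or> s = 1 \<and> C2 = skeleton s V2"
  shows "vertex_decomposable (join_complex s V1 V2 C1 C2)"
  using assms
proof (induction V1 arbitrary: s C1 C2 rule: finite_psubset_induct)
  case (psubset V1)
  note fin = psubset.hyps psubset.prems(1)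
  note fc = psubset.prems(3,4)[THEN vertex_decomposable_finite_complex]
  show ?case
  proof (cases "s = 1")
    case True
    \<comment> \<open>Here \<open>C2\<close> is the full skeleton, so the complex is pure of
      codimension one.\<close>
    then show ?thesis
      using psubset.prems fin fc finite_complex_join_complex
        codim_pure_join_complex_skeleton[of V1 V2 s C1]
      by (intro vertex_decomposable_codim_1[of "V1 \<union> V2"]) auto
  next
    case False
    then obtain t where t: "s = Suc t" "t \<ge> 1"
      using psubset.prems(7) by (cases s) auto
    show ?thesis
    proof (cases "V1 = {}")
      case True
      \<comment> \<open>With \<open>V1\<close> empty, the second condition always applies and says
        that \<open>F\<close> is in \<open>C2\<close>; the first never applies to faces of
        \<open>C2\<close>, as they miss points of \<open>V2\<close>.\<close>
      have "F \<inter> V2 = F" "\<not> V2 \<subseteq> F" if "F \<in> skeleton s V2" for F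
      proof -
        show "F \<inter> V2 = F" using that by (auto simp: skeleton_def)
        show "\<not> V2 \<subseteq> F"
        proof
          assume "V2 \<subseteq> F"
          then have "F = V2" using that by (auto simp: skeleton_def)
          then show False using that t by (auto simp: skeleton_def)
        qed
      qed
      then have "join_complex s V1 V2 C1 C2 = C2"
        using psubset.prems(6) True by (auto simp: join_complex_def)
      then show ?thesis using psubset.prems by simp
    next
      case False
      obtain v where v: "v \<in> V1" "vertex_decomposable (link C1 v)"
        "vertex_decomposable (deletion C1 v)" "codim_pure t (V1 - {v}) (deletion C1 v)"
        using codim_pure_shedding_vertex psubset.prems(3,5) fin(1) False t by metis
      have sub: "V1 - {v} \<subset> V1" using v by auto
      have dis: "(V1 - {v}) \<inter> V2 = {}" using psubset.prems(2) by auto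
      have Diff: "V1 \<union> V2 - {v} = (V1 - {v}) \<union> V2" using psubset.prems(2) v by auto
      note lnk = link_join_complex[OF fin psubset.prems(2) v(1)]
      note del = deletion_join_complex[OF fin psubset.prems(2) v(1)]
      show ?thesis
      proof (rule vertex_decomposable_shed_pure[of "V1 \<union> V2" v _ t])
        show "finite_complex (join_complex s V1 V2 C1 C2)"
          using fin fc by (rule finite_complex_join_complex)
        show "join_complex s V1 V2 C1 C2 \<subseteq> skeleton (Suc t) (V1 \<union> V2)"
          using t by (auto simp: join_complex_def)
        \<comment> \<open>Purity is available for the deletion, whose second component is a full
          skeleton, even if the complex itself is not pure.\<close>
        show "codim_pure t (V1 \<union> V2 - {v}) (deletion (join_complex s V1 V2 C1 C2) v)"
          unfolding t(1) del Diff
          using fin dis v t by (intro codim_pure_join_complex_skeleton) auto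
        show "vertex_decomposable (link (join_complex s V1 V2 C1 C2) v)"
          unfolding lnk
          using psubset.prems v dis codim_pure_link[OF psubset.prems(5) fin(1) v(1)]
          by (intro psubset.IH[OF sub]) auto
        show "vertex_decomposable (deletion (join_complex s V1 V2 C1 C2) v)"
          unfolding t(1) del
          using fin v t dis vertex_decomposable_skeleton[OF fin(2)]
          by (intro psubset.IH[OF sub]) auto
      qed (use fin v in auto)
    qed
  qed
qed

text \<open>Recovers \<open>C1\<close> as the link of \<open>V2\<close>. A face of \<open>C1\<close>
  is a proper subset of \<open>V1\<close> because \<open>s\<close> is positive, so its union with
  \<open>V2\<close> meets no condition from \<open>C2\<close>.\<close>

lemma join_complex_link_face:
  assumes fin: "finite V1" "finite V2" and dis: "V1 \<inter> V2 = {}"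
    and C1: "C1 \<subseteq> skeleton s V1" and s: "s \<ge> 1"
  shows "{F. F \<inter> V2 = {} \<and> F \<union> V2 \<in> join_complex s V1 V2 C1 C2} = C1" (is "?L = C1")
proof (intro equalityI subsetI)
  fix F assume "F \<in> ?L"
  then have F: "F \<inter> V2 = {}" "F \<union> V2 \<subseteq> V1 \<union> V2" "(F \<union> V2) \<inter> V1 \<in> C1"
    by (auto simp: join_complex_def skeleton_def)
  have "(F \<union> V2) \<inter> V1 = F" using F(1,2) dis by auto
  then show "F \<in> C1" using F by simp
next
  fix F assume F: "F \<in> C1"
  then have F1: "F \<subseteq> V1" "card F + s \<le> card V1" using C1 by (auto simp: skeleton_def)
  have dF: "F \<inter> V2 = {}" using F1 dis by auto
  have "card (F \<union> V2) = card F + card V2"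
    using fin F1 dF finite_subset[of F V1] by (intro card_Un_disjoint) auto
  moreover have "card (V1 \<union> V2) = card V1 + card V2" using fin dis by (simp add: card_Un_disjoint)
  ultimately have "F \<union> V2 \<in> skeleton s (V1 \<union> V2)" using F1 by (auto simp: skeleton_def)
  moreover have "F \<noteq> V1" using F1 s by auto
  then have "\<not> V1 \<subseteq> F \<union> V2" using F1 dis by auto
  moreover have "(F \<union> V2) \<inter> V1 = F" using F1 dis by auto
  ultimately show "F \<in> ?L" using F dF by (auto simp: join_complex_def)
qed


section \<open>Graph joins\<close>

abbreviation connected_on :: "'a pair_pre_digraph \<Rightarrow> 'a set \<Rightarrow> bool" where
  "connected_on H W \<equiv> Digraph_Component.connected (with_proj H \<restriction> W)"

lemma mem_Sigma_complex:
  "F \<in> Sigma_complex r H \<longleftrightarrow> F \<subseteq> pverts H \<and>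
     (\<exists>W. W \<subseteq> pverts H - F \<and> card W = r \<and> connected_on H W)"
  by (auto simp: Sigma_complex_def generated_complex_def)

text \<open>All generators \<open>pverts H - W\<close> have the same size, since
  \<open>card W = r\<close>.\<close>

lemma codim_pure_Sigma_complex:
  assumes "finite (pverts H)"
  shows "codim_pure r (pverts H) (Sigma_complex r H)"
  unfolding codim_pure_def
proof (intro ballI conjI)
  fix F assume F: "F \<in> Sigma_complex r H"
  then obtain W where W: "W \<subseteq> pverts H - F" "card W = r" "connected_on H W"
    and sub: "F \<subseteq> pverts H"
    by (auto simp: mem_Sigma_complex)
  show "F \<subseteq> pverts H" by fact
  have fW: "finite W" using W assms finite_subset[of W "pverts H"] by auto
  have "card W \<le> card (pverts H)" using W assms by (intro card_mono) auto
  moreover have "card (pverts H - W) = card (pverts H) - card W"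
    using W fW by (intro card_Diff_subset) auto
  ultimately have card_E: "card (pverts H - W) + r = card (pverts H)" using W by simp
  have FE: "F \<subseteq> pverts H - W" using W sub by auto
  show "card F + r \<le> card (pverts H)" using card_mono[OF _ FE] assms card_E by simp
  have "pverts H - W \<in> Sigma_complex r H"
    using W by (auto simp: mem_Sigma_complex intro!: exI[of _ W])
  then show "\<exists>E\<in>Sigma_complex r H. F \<subseteq> E \<and> card E + r = card (pverts H)"
    using FE card_E by blast
qed

section \<open>Connected vertex sets in a join\<close>

lemma graph_join_commute: "graph_join G1 G2 = graph_join G2 G1"
  by (auto simp: graph_join_def)

lemma pverts_graph_join [simp]: "pverts (graph_join G1 G2) = pverts G1 \<union> pverts G2"
  by (simp add: graph_join_def)

text \<open>Every arc that the join adds to \<open>G1\<close> has an end in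
  \<open>pverts G2\<close>, so both graphs induce the same subgraph on \<open>W\<close>.\<close>

lemma connected_on_graph_join_left:
  assumes "pair_graph G2" "pverts G1 \<inter> pverts G2 = {}" "W \<subseteq> pverts G1"
  shows "connected_on (graph_join G1 G2) W \<longleftrightarrow> connected_on G1 W"
proof -
  interpret G2: pair_graph G2 by fact
  have "with_proj (graph_join G1 G2) \<restriction> W = with_proj G1 \<restriction> W"
    using assms(2,3) G2.wellformed'
    by (fastforce simp: induce_subgraph_def graph_join_def)
  then show ?thesis by simp
qed

text \<open>Points of \<open>W\<close> in \<open>pverts G2\<close> are adjacent to \<open>a\<close>;
  the others are adjacent to \<open>b\<close>, and hence reach \<open>a\<close> in two
  steps.\<close>

lemma connected_on_graph_join_meets_both:
  assumes W: "W \<subseteq> pverts G1 \<union> pverts G2" and a: "a \<in> W" "a \<in> pverts G1" and b: "b \<in> W" "b \<in> pverts G2"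
  shows "connected_on (graph_join G1 G2) W"
proof -
  let ?H = "with_proj (graph_join G1 G2) \<restriction> W"
  let ?R = "(arcs_ends ?H)\<^sup>s"
  have edge: "(x, y) \<in> ?R" if "x \<in> W" "y \<in> W"
    "x \<in> pverts G1 \<and> y \<in> pverts G2 \<or> x \<in> pverts G2 \<and> y \<in> pverts G1" for x y
    using that by (force simp: symcl_def arcs_ends_conv induce_subgraph_def graph_join_def)
  have step: "(x, y) \<in> rtrancl_on W ?R" if "x \<in> W" "y \<in> W" "(x, y) \<in> ?R" for x y
    using that by (meson rtrancl_on_into_rtrancl_on rtrancl_on_refl)
  have to_a: "(x, a) \<in> rtrancl_on W ?R \<and> (a, x) \<in> rtrancl_on W ?R" if "x \<in> W" for x
  proof (cases "x \<in> pverts G2")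
    case True
    then show ?thesis using that a edge step by blast
  next
    case False
    then have "x \<in> pverts G1" using that W by auto
    then have "(x, b) \<in> rtrancl_on W ?R" "(b, a) \<in> rtrancl_on W ?R"
      "(a, b) \<in> rtrancl_on W ?R" "(b, x) \<in> rtrancl_on W ?R"
      using that a b edge step by blast+
    then show ?thesis by (blast intro: rtrancl_on_trans)
  qed
  then have "(x, y) \<in> rtrancl_on W ?R" if "x \<in> W" "y \<in> W" for x y
    using that by (blast intro: rtrancl_on_trans)
  then show ?thesis unfolding connected_conv using a by auto
qed

text \<open>If \<open>F\<close> covers one part, a connected set avoiding \<open>F\<close> lies in
  the other part. If it covers neither, an \<open>r\<close>-set outside \<open>F\<close> can be
  chosen to meet both.\<close>

lemma Sigma_complex_graph_join:
  assumes r: "r \<ge> 2" and G: "pair_graph G1" "pair_graph G2"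
    and dis: "pverts G1 \<inter> pverts G2 = {}"
  shows "Sigma_complex r (graph_join G1 G2) =
    join_complex r (pverts G1) (pverts G2) (Sigma_complex r G1) (Sigma_complex r G2)"
    (is "?L = ?R")
proof -
  let ?H = "graph_join G1 G2" and ?V1 = "pverts G1" and ?V2 = "pverts G2"
  interpret G1: pair_graph G1 by fact
  interpret G2: pair_graph G2 by fact
  have fin: "finite ?V1" "finite ?V2" by simp_all
  have c1: "connected_on ?H W \<longleftrightarrow> connected_on G1 W" if "W \<subseteq> ?V1" for W
    using connected_on_graph_join_left[OF G(2) dis that] .
  have c2: "connected_on ?H W \<longleftrightarrow> connected_on G2 W" if "W \<subseteq> ?V2" for W
    using connected_on_graph_join_left[of G1 G2 W] that dis G(1)
    by (simp add: graph_join_commute[of G1] Int_commute)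
  show ?thesis
  proof (intro equalityI subsetI)
    fix F assume F: "F \<in> ?L"
    then obtain W where W: "W \<subseteq> (?V1 \<union> ?V2) - F" "card W = r" "connected_on ?H W"
      by (auto simp: mem_Sigma_complex)
    have "F \<in> skeleton r (?V1 \<union> ?V2)"
      using F codim_pure_skeleton[OF codim_pure_Sigma_complex[of ?H r]] fin by auto
    moreover have "F \<inter> ?V1 \<in> Sigma_complex r G1" if "?V2 \<subseteq> F"
    proof -
      have "W \<subseteq> ?V1 - F \<inter> ?V1" using W that by auto
      then show ?thesis using W c1[of W] by (auto simp: mem_Sigma_complex)
    qed
    moreover have "F \<inter> ?V2 \<in> Sigma_complex r G2" if "?V1 \<subseteq> F"
    proof -
      have "W \<subseteq> ?V2 - F \<inter> ?V2" using W that by auto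
      then show ?thesis using W c2[of W] by (auto simp: mem_Sigma_complex)
    qed
    ultimately show "F \<in> ?R" by (simp add: join_complex_def)
  next
    fix F assume F: "F \<in> ?R"
    then have sub: "F \<subseteq> ?V1 \<union> ?V2" and le: "card F + r \<le> card (?V1 \<union> ?V2)"
      by (auto simp: join_complex_def skeleton_def)
    have "\<exists>W. W \<subseteq> (?V1 \<union> ?V2) - F \<and> card W = r \<and> connected_on ?H W"
    proof (cases "?V2 \<subseteq> F \<or> ?V1 \<subseteq> F")
      case True
      then have "F \<inter> ?V1 \<in> Sigma_complex r G1 \<or> F \<inter> ?V2 \<in> Sigma_complex r G2"
        using F by (auto simp: join_complex_def)
      then show ?thesis
      proof
        assume "F \<inter> ?V1 \<in> Sigma_complex r G1"
        then obtain W where "W \<subseteq> ?V1 - F \<inter> ?V1" "card W = r" "connected_on G1 W"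
          unfolding mem_Sigma_complex by blast
        then show ?thesis using c1[of W] by (intro exI[of _ W]) auto
      next
        assume "F \<inter> ?V2 \<in> Sigma_complex r G2"
        then obtain W where "W \<subseteq> ?V2 - F \<inter> ?V2" "card W = r" "connected_on G2 W"
          unfolding mem_Sigma_complex by blast
        then show ?thesis using c2[of W] by (intro exI[of _ W]) auto
      qed
    next
      case False
      then obtain a b where ab: "a \<in> ?V1" "a \<notin> F" "b \<in> ?V2" "b \<notin> F" by blast
      \<comment> \<open>This is where \<open>r\<close> being at least 2 matters: \<open>W\<close>
        must hold a point of each part.\<close>
      have "card {a, b} \<le> r" using r card_insert_le_m1[of 2 "{b}" a] by simp
      moreover have "finite F" using sub fin by (simp add: finite_subset)
      then have "r \<le> card ((?V1 \<union> ?V2) - F)"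
        using le sub by (simp add: card_Diff_subset)
      ultimately obtain W where W: "{a, b} \<subseteq> W" "W \<subseteq> (?V1 \<union> ?V2) - F" "card W = r"
        using exists_subset_between[of "{a, b}" r "(?V1 \<union> ?V2) - F"] ab fin by auto
      then have "connected_on ?H W"
        using ab by (intro connected_on_graph_join_meets_both[of W G1 G2 a b]) auto
      then show ?thesis using W by blast
    qed
    then show "F \<in> ?L" using sub by (simp add: mem_Sigma_complex)
  qed
qed

lemma vertex_decomposable_Sigma_complex_graph_join_left:
  assumes "r \<ge> 2" "pair_graph G1" "pair_graph G2" "pverts G1 \<inter> pverts G2 = {}"
    "vertex_decomposable (Sigma_complex r (graph_join G1 G2))"
  shows "vertex_decomposable (Sigma_complex r G1)"
proof -
  interpret G1: pair_graph G1 by fact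
  interpret G2: pair_graph G2 by fact
  have fin: "finite (pverts G1)" "finite (pverts G2)" by simp_all
  show ?thesis
    using vertex_decomposable_link_face[OF fin(2) assms(5)]
      join_complex_link_face[OF fin assms(4)
        codim_pure_skeleton[OF codim_pure_Sigma_complex[OF fin(1)]], of r] assms(1)
    by (simp add: Sigma_complex_graph_join[OF assms(1-4)])
qed

theorem theorem3p14:
  fixes G1 G2 :: "'a pair_pre_digraph" and r :: nat
  assumes "r \<ge> 2"
    and "pair_graph G1" and "pair_graph G2"
    and "pverts G1 \<inter> pverts G2 = {}"
  shows "vertex_decomposable (Sigma_complex r (graph_join G1 G2)) \<longleftrightarrow>
    vertex_decomposable (Sigma_complex r G1) \<and> vertex_decomposable (Sigma_complex r G2)"
proof (intro iffI conjI)
  assume vd: "vertex_decomposable (Sigma_complex r (graph_join G1 G2))"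
  show "vertex_decomposable (Sigma_complex r G1)"
    using vertex_decomposable_Sigma_complex_graph_join_left[OF assms vd] .
  show "vertex_decomposable (Sigma_complex r G2)"
    \<comment> \<open>The join is symmetric, so the parts can be exchanged.\<close>
    using vertex_decomposable_Sigma_complex_graph_join_left[of r G2 G1] assms vd
    by (simp add: graph_join_commute[of G1] Int_commute)
next
  interpret G1: pair_graph G1 by fact
  interpret G2: pair_graph G2 by fact
  have fin: "finite (pverts G1)" "finite (pverts G2)" by simp_all
  assume "vertex_decomposable (Sigma_complex r G1) \<and> vertex_decomposable (Sigma_complex r G2)"
  then show "vertex_decomposable (Sigma_complex r (graph_join G1 G2))"
    unfolding Sigma_complex_graph_join[OF assms]
    using fin assms(1,4) codim_pure_Sigma_complex[OF fin(1)]
      codim_pure_skeleton[OF codim_pure_Sigma_complex[OF fin(2)]]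
    by (intro vertex_decomposable_join_complex) auto
qed

end
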